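(* Consider the space homogeneous IMEX scheme $$F^{(i)} = \sum_{h=1}^{i}\hat{b}_{ih}\Big\{\lambda f^n + \sum_{j=1}^{h-1}\widetilde{a}_{hj}\frac{P(F^{(j)},F^{(j)})}{\mu}+ M[f^n]\,(c_h-\widetilde{c}_h)\Big\},\qquad i=1,\dots,\nu,$$ $$f^{n+1} = f^{n}+\frac{\mu\Delta t}{\varepsilon}\sum_{i=1}^{\nu}\widetilde{w}_{i}\Big(\frac{P(F^{(i)},F^{(i)})}{\mu}-M[f^n]\Big)+\frac{\mu\Delta t}{\varepsilon}\sum_{i=1}^{\nu}w_{i}\big(M[f^n]-F^{(i)}\big),$$ where $\lambda=\varepsilon/(\mu\Delta t)$ and $\hat b_{ij}$ are the elements of $(\lambda I+A)^{-1}$. A sufficient condition to guarantee that $f^{n+1}\ge0$ whenever $f^n\ge0$ is that the scheme is globally stiffly accurate, i.e. $w_i=a_{\nu i}$ and $\widetilde w_i=\widetilde a_{\nu i}$ for all $i=1,\dots,\nu$, and that $$0\leq\sum_{h=1}^{i}\hat{b}_{ih}c_h\leq 1,\qquad 0\leq\sum_{h=1}^{i}\hat{b}_{ih}\left(c_{h}-\widetilde{c}_h\right)\leq 1,\qquad i=1,\ldots,\nu,$$ $$0\leq \sum_{h=j+1}^{i}\hat{b}_{ih}\widetilde{a}_{hj}\leq 1,\qquad i=1,\ldots,\nu,\quad j=1,\ldots,i-1.$$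
   Context: The scheme approximates the space homogeneous Boltzmann equation $\partial_t f=\frac1\varepsilon Q_B(f,f)$, $f=f(v,t)\ge 0$, $v\in\mathbb R^3$, with Knudsen number $\varepsilon>0$ and time step $\Delta t>0$. Here $$Q_B(f,f)(v)=\int_{\mathbb R^3\times S^2}B(|v-v_*|,n)\,[f(v')f(v'_* )-f(v)f(v_* )]\,dv_*\,dn,$$ $v'=\frac{v+v_*}{2}+\frac12|v-v_*|n$, $v'_*=\frac{v+v_*}{2}-\frac12|v-v_*|n$, and $B\ge0$ is a collision kernel. Moments: $(\rho,\rho w,E)^T=\int_{\mathbb R^3} f\,(1,v,|v|^2/2)^T dv$ and $T=\frac1{3\rho}(2E-\rho|w|^2)$ (here $w$ without index is the mean velocity; $w_i$ are Runge-Kutta weights). Maxwellian: $M[f]=\frac{\rho}{(2\pi T)^{3/2}}\exp\big(-\frac{|w-v|^2}{2T}\big)$, with the moments of $f$. $\mu>0$ is a constant such that $P(f,f):=Q_B(f,f)+\mu f\ge 0$ for the nonnegative densities $f$ under consideration, namely those with the same moments $\rho,w,T$ as $f^n$ (with $\rho,T>0$). One has $\frac1\mu\int_{\mathbb R^3} P(f,f)(1,v,|v|^2/2)^Tdv=\int_{\mathbb R^3} f\,(1,v,|v|^2/2)^Tdv$. Runge-Kutta coefficients: $\widetilde A=(\widetilde a_{ij})$ is a real $\nu\times\nu$ matrix with $\widetilde a_{ij}=0$ for $j\ge i$, $\widetilde c_i=\sum_{j=1}^{i-1}\widetilde a_{ij}$, and weights $\widetilde w_1,\dots,\widetilde w_\nu$;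 $A=(a_{ij})$ is a real $\nu\times\nu$ matrix with $a_{ij}=0$ for $j>i$, $c_i=\sum_{j=1}^{\nu}a_{ij}$, and weights $w_1,\dots,w_\nu$. The matrix $\lambda I+A$ is invertible. *)

theory Defs
  imports "HOL-Analysis.Analysis"
begin

text \<open>
  Surface measure on the unit sphere of three-space, as a Borel measure on the ambient space.
  It is the cone measure: the area of \<open>S \<subseteq> sphere 0 1\<close> is three times the volume of the
  cone over \<open>S\<close> within the unit ball, and \<open>sgn x = x /\<^sub>R norm x\<close> projects radially
  (the null set \<open>{0}\<close> is irrelevant).
\<close>

definition sphere_measure :: "(real^3) measure" where
  "sphere_measure = scale_measure 3 (distr (restrict_space lborel (ball 0 1)) borel sgn)"

lemma emeasure_sphere_measure_UNIV: "emeasure sphere_measure UNIV = ennreal (4 * pi)"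
proof -
  have [measurable]: "sgn \<in> restrict_space lborel (ball (0::real^3) 1) \<rightarrow>\<^sub>M borel"
    by (intro measurable_restrict_space1) measurable
  have "emeasure (distr (restrict_space lborel (ball (0::real^3) 1)) borel sgn) UNIV
      = emeasure lborel (ball (0::real^3) 1)"
    by (subst emeasure_distr) (auto simp: emeasure_restrict_space space_restrict_space)
  also have "\<dots> = ennreal (4 / 3 * pi)"
    by (subst emeasure_ball) (auto simp: unit_ball_vol_3)
  finally show ?thesis
    by (simp add: sphere_measure_def ennreal_mult' [symmetric] flip: ennreal_numeral)
qed

definition v_post :: "real^3 \<Rightarrow> real^3 \<Rightarrow> real^3 \<Rightarrow> real^3" where
  "v_post v u n = (1/2) *\<^sub>R (v + u) + (norm (v - u) / 2) *\<^sub>R n"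

definition u_post :: "real^3 \<Rightarrow> real^3 \<Rightarrow> real^3 \<Rightarrow> real^3" where
  "u_post v u n = (1/2) *\<^sub>R (v + u) - (norm (v - u) / 2) *\<^sub>R n"

definition collision ::
    "(real \<Rightarrow> real^3 \<Rightarrow> real) \<Rightarrow> (real^3 \<Rightarrow> real) \<Rightarrow> real^3 \<Rightarrow> real" where
  "collision B f v =
     (LINT (u, n)|(lborel \<Otimes>\<^sub>M sphere_measure).
        B (norm (v - u)) n * (f (v_post v u n) * f (u_post v u n) - f v * f u))"

definition P_op ::
    "(real \<Rightarrow> real^3 \<Rightarrow> real) \<Rightarrow> real \<Rightarrow> (real^3 \<Rightarrow> real) \<Rightarrow> real^3 \<Rightarrow> real" where
  "P_op B \<mu> f v = collision B f v + \<mu> * f v"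

definition has_moments :: "(real^3 \<Rightarrow> real) \<Rightarrow> bool" where
  "has_moments f \<longleftrightarrow>
     integrable lborel f \<and>
     integrable lborel (\<lambda>v. f v *\<^sub>R v) \<and>
     integrable lborel (\<lambda>v. f v * ((norm v)\<^sup>2 / 2))"

definition mass :: "(real^3 \<Rightarrow> real) \<Rightarrow> real" where
  "mass f = (LINT v|lborel. f v)"

definition momentum :: "(real^3 \<Rightarrow> real) \<Rightarrow> real^3" where
  "momentum f = (LINT v|lborel. f v *\<^sub>R v)"

definition energy :: "(real^3 \<Rightarrow> real) \<Rightarrow> real" where
  "energy f = (LINT v|lborel. f v * ((norm v)\<^sup>2 / 2))"

definition mean_velocity :: "(real^3 \<Rightarrow> real) \<Rightarrow> real^3" where
  "mean_velocity f = (1 / mass f) *\<^sub>R momentum f"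

definition temperature :: "(real^3 \<Rightarrow> real) \<Rightarrow> real" where
  "temperature f = 1 / (3 * mass f) * (2 * energy f - mass f * (norm (mean_velocity f))\<^sup>2)"

definition maxwellian :: "(real^3 \<Rightarrow> real) \<Rightarrow> real^3 \<Rightarrow> real" where
  "maxwellian f v =
     mass f / (2 * pi * temperature f) powr (3/2)
       * exp (- ((norm (mean_velocity f - v))\<^sup>2 / (2 * temperature f)))"

text \<open>The nonnegative densities sharing the moments \<open>\<rho>, w, T\<close> of a given one.\<close>

definition same_moment_densities :: "(real^3 \<Rightarrow> real) \<Rightarrow> (real^3 \<Rightarrow> real) set" where
  "same_moment_densities g =
     {f. (\<forall>v. 0 \<le> f v) \<and> has_moments f \<and> mass f = mass g \<and>
         mean_velocity f = mean_velocity g \<and> temperature f = temperature g}"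

text \<open>
  Runge--Kutta stages are indexed by an arbitrary finite linearly ordered type, whose order
  type is \<open>{1..\<nu>}\<close> with \<open>\<nu> = CARD('s)\<close>; the last stage \<open>\<nu>\<close> is \<open>Max UNIV\<close>.
\<close>

type_synonym 's weights = "(real, 's) vec"
type_synonym 's tableau = "((real, 's) vec, 's) vec"

definition explicit_tableau :: "('s::{finite,linorder}) tableau \<Rightarrow> bool" where
  "explicit_tableau At \<longleftrightarrow> (\<forall>i j. j \<ge> i \<longrightarrow> At $ i $ j = 0)"

definition diag_implicit_tableau :: "('s::{finite,linorder}) tableau \<Rightarrow> bool" where
  "diag_implicit_tableau A \<longleftrightarrow> (\<forall>i j. j > i \<longrightarrow> A $ i $ j = 0)"

definition c_ex :: "('s::{finite,linorder}) tableau \<Rightarrow> 's \<Rightarrow> real" where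
  "c_ex At i = (\<Sum>j<i. At $ i $ j)"

definition c_im :: "('s::finite) tableau \<Rightarrow> 's \<Rightarrow> real" where
  "c_im A i = (\<Sum>j\<in>UNIV. A $ i $ j)"

definition globally_stiffly_accurate ::
    "('s::{finite,linorder}) tableau \<Rightarrow> 's tableau \<Rightarrow> 's weights \<Rightarrow> 's weights \<Rightarrow> bool" where
  "globally_stiffly_accurate At A wt w \<longleftrightarrow>
     (\<forall>i. w $ i = A $ (Max UNIV) $ i) \<and> (\<forall>i. wt $ i = At $ (Max UNIV) $ i)"

text \<open>\<open>mat lam\<close> is \<open>lam\<close> times the identity.\<close>

definition bhat :: "real \<Rightarrow> ('s::finite) tableau \<Rightarrow> 's tableau" where
  "bhat lam A = matrix_inv (mat lam + A)"

definition imex_stages ::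
    "(real \<Rightarrow> real^3 \<Rightarrow> real) \<Rightarrow> real \<Rightarrow> real \<Rightarrow> ('s::{finite,linorder}) tableau \<Rightarrow> 's tableau
      \<Rightarrow> (real^3 \<Rightarrow> real) \<Rightarrow> ('s \<Rightarrow> real^3 \<Rightarrow> real) \<Rightarrow> bool" where
  "imex_stages B \<mu> lam At A f F \<longleftrightarrow>
     (\<forall>i v. F i v =
        (\<Sum>h\<le>i. bhat lam A $ i $ h *
           (lam * f v + (\<Sum>j<h. At $ h $ j * (P_op B \<mu> (F j) v / \<mu>))
             + maxwellian f v * (c_im A h - c_ex At h))))"

definition imex_update ::
    "(real \<Rightarrow> real^3 \<Rightarrow> real) \<Rightarrow> real \<Rightarrow> real \<Rightarrow> real \<Rightarrow> ('s::{finite,linorder}) weights \<Rightarrow> 's weights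
      \<Rightarrow> (real^3 \<Rightarrow> real) \<Rightarrow> ('s \<Rightarrow> real^3 \<Rightarrow> real) \<Rightarrow> real^3 \<Rightarrow> real" where
  "imex_update B \<mu> \<epsilon> \<Delta>t wt w f F v =
     f v + \<mu> * \<Delta>t / \<epsilon> * (\<Sum>i\<in>UNIV. wt $ i * (P_op B \<mu> (F i) v / \<mu> - maxwellian f v))
         + \<mu> * \<Delta>t / \<epsilon> * (\<Sum>i\<in>UNIV. w $ i * (maxwellian f v - F i v))"

end

theory Submission
  imports Defs "HOL-Probability.Distributions"
begin

text \<open>
  Write \<open>p\<^sub>j = P(F\<^sub>j, F\<^sub>j) / \<mu>\<close> and \<open>M\<close> for the Maxwellian of \<open>f\<close>. The proof combines an algebraic
  reduction of the new value to the last stage with an induction that keeps all stages inside the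
  set of nonnegative densities having the moments of \<open>f\<close>.

  Reduction. The matrix \<open>\<lambda> I + A\<close> is lower triangular, hence so is its inverse
  (\<open>matrix_inv_lower_triangular\<close>), and the truncated sums defining the stages are full
  matrix-vector products. Multiplying them by \<open>\<lambda> I + A\<close> gives the usual implicit form
  of the stages (\<open>stage_implicit_form\<close>). Its last row contains, by global stiff accuracy, exactly the
  sums over \<open>wt\<close> and \<open>w\<close> that occur in the update, so the new value equals the last
  stage (\<open>imex_update_eq_last_stage\<close>).

  Induction. Collecting terms, each stage is a linear combination of \<open>f\<close>, of the \<open>p\<^sub>j\<close> of earlier
  stages and of \<open>M\<close> (\<open>stage_expansion\<close>). The sign conditions make the weights of \<open>p\<^sub>j\<close> and \<open>M\<close>
  nonnegative. Applying \<open>\<lambda> I + A\<close> to the constant vector 1 yields the row identity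
  \<open>\<lambda> \<Sum>\<^sub>h bhat\<^sub>i\<^sub>h = 1 - \<Sum>\<^sub>h bhat\<^sub>i\<^sub>h c\<^sub>h\<close> (\<open>bhat_row_sum\<close>). By the bound
  \<open>\<Sum>\<^sub>h bhat\<^sub>i\<^sub>h c\<^sub>h \<le> 1\<close> the weight \<open>\<lambda> \<Sum>\<^sub>h bhat\<^sub>i\<^sub>h\<close> of \<open>f\<close> is nonnegative too, and the row identity
  also makes all the weights sum to 1 (\<open>stage_weights_sum\<close>). So every stage is a convex combination.

  Positivity of \<open>p\<^sub>j\<close> is only known when \<open>F\<^sub>j\<close> has the mass, mean velocity and temperature of \<open>f\<close>.
  The induction therefore carries these moments along. In terms of mass, momentum and energy
  they are linear and so preserved by convex combinations; \<open>p\<^sub>j\<close> has them by conservation, and \<open>M\<close> has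
  them by the Gaussian integrals (\<open>maxwellian_moments\<close>).
\<close>

section \<open>Moments of Gaussian densities\<close>

text \<open>
  Lebesgue measure is the image of the product of the Lebesgue measures on the coordinate axes, so
  integrals of products of functions of single coordinates factorize.
\<close>

lemma has_bochner_integral_lborel_prod:
  fixes g :: "'a::euclidean_space \<Rightarrow> real \<Rightarrow> real"
  assumes "\<And>b. b \<in> Basis \<Longrightarrow> has_bochner_integral lborel (g b) (m b)"
  shows "has_bochner_integral lborel (\<lambda>x. \<Prod>b\<in>Basis. g b (x \<bullet> b)) (\<Prod>b\<in>Basis. m b)"
proof -
  interpret product_sigma_finite "\<lambda>b::'a. lborel :: real measure" ..
  have int: "\<And>b. b \<in> Basis \<Longrightarrow> integrable lborel (g b)"
    using assms by (auto simp: has_bochner_integral_iff)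
  have [measurable]: "\<And>b. b \<in> Basis \<Longrightarrow> g b \<in> borel_measurable borel"
    using int by (auto dest: borel_measurable_integrable)
  have sel: "(\<Prod>b\<in>Basis. g b ((\<Sum>c\<in>Basis. y c *\<^sub>R c) \<bullet> b)) = (\<Prod>b\<in>Basis. g b (y b))" for y
    by (intro prod.cong) (auto simp: inner_sum_left_Basis)
  have "has_bochner_integral (\<Pi>\<^sub>M b\<in>Basis. lborel)
      (\<lambda>y. \<Prod>b\<in>(Basis::'a set). g b (y b)) (\<Prod>b\<in>Basis. m b)"
    using product_integrable_prod[of "Basis::'a set" g] product_integral_prod[of "Basis::'a set" g] int assms
    by (auto simp: has_bochner_integral_iff)
  then show ?thesis
    by (subst lborel_eq, intro has_bochner_integral_distr) (auto simp: sel)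
qed

lemma power2_norm_eq_sum_Basis:
  fixes v :: "'a::euclidean_space"
  shows "(norm v)\<^sup>2 = (\<Sum>b\<in>Basis. (v \<bullet> b)\<^sup>2)"
  by (simp add: norm_eq_sqrt_inner euclidean_inner[of v v] power2_eq_square sum_nonneg)

text \<open>
  The isotropic Gaussian with mean \<open>w\<close> and variance \<open>\<sigma>\<^sup>2\<close> in each direction. The product form
  makes all its polynomial moments reducible to one-dimensional ones.
\<close>

definition gaussian :: "'a::euclidean_space \<Rightarrow> real \<Rightarrow> 'a \<Rightarrow> real" where
  "gaussian w \<sigma> v = (\<Prod>b\<in>Basis. normal_density (w \<bullet> b) \<sigma> (v \<bullet> b))"

text \<open>
  In the factorization of the integral, every coordinate other than \<open>c\<close> contributes the total mass 1
  of a normal density.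
\<close>

lemma has_bochner_integral_gaussian_marginal:
  fixes w :: "'a::euclidean_space"
  assumes "0 < \<sigma>" and c: "c \<in> Basis"
    and q: "has_bochner_integral lborel (\<lambda>x. normal_density (w \<bullet> c) \<sigma> x * q x) m"
  shows "has_bochner_integral lborel (\<lambda>v. gaussian w \<sigma> v * q (v \<bullet> c)) m"
proof -
  let ?g = "\<lambda>b x. normal_density (w \<bullet> b) \<sigma> x * (if b = c then q x else 1)"
  have "has_bochner_integral lborel (?g b) (if b = c then m else 1)" for b
    using q \<open>0 < \<sigma>\<close> by (cases "b = c") (auto simp: has_bochner_integral_iff)
  then have "has_bochner_integral lborel (\<lambda>v. \<Prod>b\<in>Basis. ?g b (v \<bullet> b))
      (\<Prod>b\<in>Basis. if b = c then m else 1)"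
    by (rule has_bochner_integral_lborel_prod)
  moreover have "(\<Prod>b\<in>Basis. ?g b (v \<bullet> b)) = gaussian w \<sigma> v * q (v \<bullet> c)" for v
    using c by (simp only: gaussian_def prod.distrib prod.delta finite_Basis if_True)
  moreover have "(\<Prod>b\<in>(Basis::'a set). if b = c then m else 1) = m"
    using c by (simp only: prod.delta finite_Basis if_True)
  ultimately show ?thesis
    by (simp only:)
qed

lemma gaussian_moment_mass:
  fixes w :: "'a::euclidean_space"
  assumes "0 < \<sigma>"
  shows "has_bochner_integral lborel (gaussian w \<sigma>) 1"
proof -
  have "has_bochner_integral lborel (\<lambda>x. normal_density (w \<bullet> c) \<sigma> x * 1) 1" for c
    using assms by (auto simp: has_bochner_integral_iff)
  from has_bochner_integral_gaussian_marginal[OF assms SOME_Basis this] show ?thesis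
    by simp
qed

lemma gaussian_moment_momentum:
  fixes w :: "'a::euclidean_space"
  assumes "0 < \<sigma>"
  shows "has_bochner_integral lborel (\<lambda>v. gaussian w \<sigma> v *\<^sub>R v) w"
proof -
  have "has_bochner_integral lborel (\<lambda>v. gaussian w \<sigma> v * (v \<bullet> b)) (w \<bullet> b)" if "b \<in> Basis" for b
    using has_bochner_integral_gaussian_marginal[OF assms that normal_moment_nz_1[OF assms]] .
  then have "has_bochner_integral lborel (\<lambda>v. \<Sum>b\<in>Basis. (gaussian w \<sigma> v * (v \<bullet> b)) *\<^sub>R b)
      (\<Sum>b\<in>Basis. (w \<bullet> b) *\<^sub>R b)"
    by (intro has_bochner_integral_sum has_bochner_integral_scaleR_left)
  moreover have "(\<Sum>b\<in>Basis. (gaussian w \<sigma> v * (v \<bullet> b)) *\<^sub>R b) = gaussian w \<sigma> v *\<^sub>R v" for v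
    by (subst (2) euclidean_representation[of v, symmetric])
       (simp add: scaleR_sum_right)
  ultimately show ?thesis
    by (simp add: euclidean_representation)
qed

text \<open>
  Expanding about the mean, \<open>x\<^sup>2 = (x - \<mu>)\<^sup>2 + 2 \<mu> x - \<mu>\<^sup>2\<close>, reduces this to the central second, the
  first and the zeroth moment.
\<close>

lemma normal_second_moment:
  assumes "0 < \<sigma>"
  shows "has_bochner_integral lborel (\<lambda>x. normal_density \<mu> \<sigma> x * x\<^sup>2) (\<sigma>\<^sup>2 + \<mu>\<^sup>2)"
proof -
  have central: "has_bochner_integral lborel (\<lambda>x. normal_density \<mu> \<sigma> x * (x - \<mu>)\<^sup>2) (\<sigma>\<^sup>2)"
    using normal_moment_even[OF assms, of \<mu> 1] by (simp add: fact_2)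
  have first: "has_bochner_integral lborel (\<lambda>x. normal_density \<mu> \<sigma> x * x) \<mu>"
    by (rule normal_moment_nz_1[OF assms])
  have zeroth: "has_bochner_integral lborel (\<lambda>x. normal_density \<mu> \<sigma> x) 1"
    using assms by (auto simp: has_bochner_integral_iff)
  have "has_bochner_integral lborel
      (\<lambda>x. normal_density \<mu> \<sigma> x * (x - \<mu>)\<^sup>2 + 2 * \<mu> * (normal_density \<mu> \<sigma> x * x)
             - \<mu>\<^sup>2 * normal_density \<mu> \<sigma> x)
      (\<sigma>\<^sup>2 + 2 * \<mu> * \<mu> - \<mu>\<^sup>2 * 1)"
    by (intro has_bochner_integral_add has_bochner_integral_diff
              has_bochner_integral_mult_right central first zeroth)
  then show ?thesis
    by (simp add: power2_eq_square algebra_simps)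
qed

lemma gaussian_moment_energy:
  fixes w :: "'a::euclidean_space"
  assumes "0 < \<sigma>"
  shows "has_bochner_integral lborel (\<lambda>v. gaussian w \<sigma> v * (norm v)\<^sup>2)
           (real DIM('a) * \<sigma>\<^sup>2 + (norm w)\<^sup>2)"
proof -
  have "has_bochner_integral lborel (\<lambda>v. \<Sum>b\<in>Basis. gaussian w \<sigma> v * (v \<bullet> b)\<^sup>2)
      (\<Sum>b\<in>(Basis::'a set). \<sigma>\<^sup>2 + (w \<bullet> b)\<^sup>2)"
    by (intro has_bochner_integral_sum has_bochner_integral_gaussian_marginal[OF assms]
              normal_second_moment[OF assms])
  then show ?thesis
    by (simp add: power2_norm_eq_sum_Basis sum_distrib_left sum.distrib)
qed

section \<open>Densities with prescribed moments\<close>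

text \<open>
  Each clause is linear jointly in \<open>g\<close> and its value, so this predicate is
  closed under linear combinations; velocity and temperature would not behave that way.
\<close>

definition moments_are :: "(real^3 \<Rightarrow> real) \<Rightarrow> real \<Rightarrow> real^3 \<Rightarrow> real \<Rightarrow> bool" where
  "moments_are g m p e \<longleftrightarrow>
     has_bochner_integral lborel g m \<and>
     has_bochner_integral lborel (\<lambda>v. g v *\<^sub>R v) p \<and>
     has_bochner_integral lborel (\<lambda>v. g v * ((norm v)\<^sup>2 / 2)) e"

lemma moments_are_iff:
  "moments_are g m p e \<longleftrightarrow> has_moments g \<and> mass g = m \<and> momentum g = p \<and> energy g = e"
  by (auto simp: moments_are_def has_moments_def mass_def momentum_def energy_def
        has_bochner_integral_iff)

lemma moments_are_add:
  assumes "moments_are g m p e" "moments_are h m' p' e'"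
  shows "moments_are (\<lambda>v. g v + h v) (m + m') (p + p') (e + e')"
  using assms unfolding moments_are_def
  by (auto simp only: scaleR_add_left distrib_right intro!: has_bochner_integral_add)

lemma moments_are_scale:
  assumes "moments_are g m p e"
  shows "moments_are (\<lambda>v. a * g v) (a * m) (a *\<^sub>R p) (a * e)"
  using assms unfolding moments_are_def
  by (auto simp only: scaleR_scaleR[symmetric] mult.assoc
        intro!: has_bochner_integral_mult_right has_bochner_integral_scaleR_right)

lemma moments_are_zero: "moments_are (\<lambda>v. 0) 0 0 0"
  by (simp add: moments_are_def has_bochner_integral_iff)

lemma moments_are_weighted_sum:
  assumes "finite J" "\<And>j. j \<in> J \<Longrightarrow> moments_are (g j) m p e"
  shows "moments_are (\<lambda>v. \<Sum>j\<in>J. \<beta> j * g j v)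
           (sum \<beta> J * m) (sum \<beta> J *\<^sub>R p) (sum \<beta> J * e)"
  using assms
proof (induction J rule: finite_induct)
  case empty
  then show ?case by (simp add: moments_are_zero)
next
  case (insert j J)
  then show ?case
    using moments_are_add[OF moments_are_scale[of "g j" m p e "\<beta> j"]]
    by (simp add: distrib_right scaleR_add_left)
qed

text \<open>
  At positive mass, \<open>(\<rho>, w, T)\<close> and \<open>(\<rho>, \<rho> w, E)\<close> determine each other, the energy being
  \<open>\<rho> (3 T + |w|\<^sup>2) / 2\<close>. This replaces the nonlinear moment constraints by linear ones.
\<close>

lemma same_moment_densities_iff:
  assumes "mass f > 0"
  shows "g \<in> same_moment_densities f \<longleftrightarrow>
           (\<forall>v. 0 \<le> g v) \<and> moments_are g (mass f) (momentum f) (energy f)"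
proof -
  have "momentum h = mass h *\<^sub>R mean_velocity h" if "mass h > 0" for h
    using that by (simp add: mean_velocity_def)
  moreover have "energy h = mass h * (3 * temperature h + (norm (mean_velocity h))\<^sup>2) / 2"
    if "mass h > 0" for h
    using that by (simp add: temperature_def field_simps)
  moreover have "mean_velocity g = mean_velocity f" "temperature g = temperature f"
    if "mass g = mass f" "momentum g = momentum f" "energy g = energy f"
    using that by (simp_all add: mean_velocity_def temperature_def)
  ultimately show ?thesis
    using assms unfolding same_moment_densities_def moments_are_iff by (auto; metis)
qed

text \<open>
  In dimension three the normalization \<open>(2 \<pi> T)\<^sup>3\<^sup>/\<^sup>2\<close> is the product of three
  one-dimensional normalizations, and the exponents of the three factors add up to the squared norm.
\<close>

lemma maxwellian_eq_gaussian:
  assumes "temperature f > 0"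
  shows "maxwellian f v = mass f * gaussian (mean_velocity f) (sqrt (temperature f)) v"
proof -
  let ?T = "temperature f" and ?w = "mean_velocity f"
  have "(\<Prod>b\<in>(Basis::(real^3) set). exp (- (v \<bullet> b - ?w \<bullet> b)\<^sup>2 / (2 * ?T)))
      = exp (- ((norm (?w - v))\<^sup>2 / (2 * ?T)))"
    by (simp add: exp_sum[symmetric] power2_norm_eq_sum_Basis inner_diff_left sum_divide_distrib
          sum_negf[symmetric] power2_commute)
  moreover have "(\<Prod>b\<in>(Basis::(real^3) set). 1 / sqrt (2 * pi * ?T)) = 1 / (2 * pi * ?T) powr (3/2)"
  proof -
    have "(2 * pi * ?T) powr (3/2) = ((2 * pi * ?T) powr (1/2)) powr 3"
      using assms by (simp add: powr_powr)
    also have "\<dots> = sqrt (2 * pi * ?T) ^ 3"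
      using assms by (simp add: powr_half_sqrt powr_numeral)
    finally show ?thesis
      by (simp add: power_divide)
  qed
  ultimately show ?thesis
    using assms
    by (simp only: maxwellian_def gaussian_def normal_density_def prod.distrib real_sqrt_pow2_iff
          real_sqrt_pow2 less_imp_le) simp
qed

lemma maxwellian_nonneg:
  assumes "mass f > 0"
  shows "0 \<le> maxwellian f v"
  using assms by (simp add: maxwellian_def)

text \<open>
  A Gaussian with mean \<open>w\<close> and variance \<open>T\<close> per direction has second moment \<open>3 T + |w|\<^sup>2\<close>; the
  temperature is defined so that the energy then matches.
\<close>

lemma maxwellian_moments:
  assumes "mass f > 0" "temperature f > 0"
  shows "moments_are (maxwellian f) (mass f) (momentum f) (energy f)"
proof -
  let ?T = "temperature f" and ?w = "mean_velocity f"
  have \<sigma>: "0 < sqrt ?T"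
    using assms by simp
  have "has_bochner_integral lborel (\<lambda>v. gaussian ?w (sqrt ?T) v * (norm v)\<^sup>2 / 2)
          ((3 * ?T + (norm ?w)\<^sup>2) / 2)"
    using has_bochner_integral_divide_zero[OF gaussian_moment_energy[OF \<sigma>, of ?w], of 2] assms
    by simp
  then have "moments_are (gaussian ?w (sqrt ?T)) 1 ?w ((3 * ?T + (norm ?w)\<^sup>2) / 2)"
    using gaussian_moment_mass[OF \<sigma>, of ?w] gaussian_moment_momentum[OF \<sigma>, of ?w]
    by (simp add: moments_are_def)
  from moments_are_scale[OF this, of "mass f"]
  have "moments_are (maxwellian f) (mass f) (mass f *\<^sub>R ?w)
          (mass f * ((3 * ?T + (norm ?w)\<^sup>2) / 2))"
    by (simp only: maxwellian_eq_gaussian[OF assms(2), symmetric] mult_1_right)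
  moreover have "mass f *\<^sub>R ?w = momentum f"
    using assms by (simp add: mean_velocity_def)
  moreover have "mass f * ((3 * ?T + (norm ?w)\<^sup>2) / 2) = energy f"
    using assms by (simp add: temperature_def field_simps)
  ultimately show ?thesis
    by simp
qed

section \<open>Inverses of lower triangular matrices\<close>

lemma matrix_inv_cancel:
  fixes T :: "real^'n^'n"
  assumes "invertible T"
  shows "T ** matrix_inv T = mat 1" "matrix_inv T ** T = mat 1"
  using someI_ex[of "\<lambda>X. T ** X = mat 1 \<and> X ** T = mat 1"] assms
  by (auto simp: invertible_def matrix_inv_def)

text \<open>
  A lower triangular matrix maps the space \<open>V\<close> of vectors vanishing before position \<open>j\<close> into
  itself. If it is invertible, it maps \<open>V\<close> onto \<open>V\<close> because the dimensions agree, so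
  its inverse preserves \<open>V\<close> too. The \<open>j\<close>-th column of the inverse, being the image of the \<open>j\<close>-th unit vector,
  thus lies in \<open>V\<close>.
\<close>

lemma matrix_inv_lower_triangular:
  fixes T :: "('s::{finite,linorder}) tableau"
  assumes inv: "invertible T" and lower: "\<And>i j. i < j \<Longrightarrow> T $ i $ j = 0" and "i < j"
  shows "matrix_inv T $ i $ j = 0"
proof -
  define V where "V = {x :: 's weights. \<forall>k<j. x $ k = 0}"
  have V: "subspace V"
    by (auto simp: V_def subspace_def)
  have T: "linear ((*v) T)" "inj ((*v) T)"
    using inj_matrix_vector_mult[OF inv] by auto
  have TV: "(*v) T ` V \<subseteq> V"
  proof (clarsimp simp: V_def matrix_vector_mult_def)
    fix x :: "'s weights" and k
    assume x: "\<forall>k<j. x $ k = 0" and "k < j"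
    have "T $ k $ l * x $ l = 0" for l
      using x lower[of k l] \<open>k < j\<close> by (cases "l < j") auto
    then show "(\<Sum>l\<in>UNIV. T $ k $ l * x $ l) = 0"
      by (intro sum.neutral ballI)
  qed
  have "dim ((*v) T ` V) = dim V"
    using dim_image_eq[of "(*v) T" V] T by (auto simp: inj_on_def)
  then have "(*v) T ` V = V"
    using subspace_dim_equal[OF linear_subspace_image[OF T(1) V] V TV] by simp
  moreover have "axis j 1 \<in> V"
    by (auto simp: V_def axis_def)
  ultimately obtain x where x: "x \<in> V" "T *v x = axis j 1"
    by (metis imageE)
  have "x = matrix_inv T *v (T *v x)"
    by (simp add: matrix_vector_mul_assoc matrix_inv_cancel[OF inv])
  also have "\<dots> = matrix_inv T *v axis j 1"
    by (simp add: x)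
  finally have "x $ i = matrix_inv T $ i $ j"
    by (simp add: matrix_vector_mult_basis column_def)
  then show ?thesis
    using x \<open>i < j\<close> by (auto simp: V_def)
qed

section \<open>The stages of the scheme\<close>

lemma mat_plus_mult_vec:
  fixes A :: "real^'n^'n"
  shows "((mat l + A) *v x) $ i = l * x $ i + (\<Sum>j\<in>UNIV. A $ i $ j * x $ j)"
proof -
  have "((mat l + A) *v x) $ i = (\<Sum>j\<in>UNIV. (if i = j then l * x $ j else 0) + A $ i $ j * x $ j)"
    unfolding matrix_vector_mult_def vec_lambda_beta
    by (intro sum.cong) (auto simp: mat_def distrib_right)
  then show ?thesis
    by (simp add: sum.distrib)
qed

lemma bhat_lower_triangular:
  assumes "invertible (mat lam + A)" "diag_implicit_tableau A" "i < j"
  shows "bhat lam A $ i $ j = 0"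
  unfolding bhat_def
  by (rule matrix_inv_lower_triangular)
     (use assms in \<open>auto simp: diag_implicit_tableau_def mat_def\<close>)

lemma bhat_mult_vec:
  assumes "invertible (mat lam + A)" "diag_implicit_tableau A"
  shows "(bhat lam A *v x) $ i = (\<Sum>h\<le>i. bhat lam A $ i $ h * x $ h)"
  unfolding matrix_vector_mult_def vec_lambda_beta
  using bhat_lower_triangular[OF assms, of i] by (intro sum.mono_neutral_right) (auto simp: not_le)

text \<open>
  Row \<open>h\<close> of \<open>\<lambda> I + A\<close> sums to \<open>\<lambda> + c\<^sub>h\<close>, so the inverse sends the vector of these row sums back to
  the constant vector 1. The identity turns an upper bound on \<open>\<Sum>\<^sub>h bhat\<^sub>i\<^sub>h c\<^sub>h\<close> into a lower bound on the
  weight of \<open>f\<close> in the stages.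
\<close>

lemma bhat_row_sum:
  assumes "invertible (mat lam + A)" "diag_implicit_tableau A"
  shows "lam * (\<Sum>h\<le>i. bhat lam A $ i $ h) = 1 - (\<Sum>h\<le>i. bhat lam A $ i $ h * c_im A h)"
proof -
  have "(mat lam + A) *v 1 = (\<chi> h. lam + c_im A h)"
    by (simp add: vec_eq_iff mat_plus_mult_vec c_im_def)
  then have "bhat lam A *v (\<chi> h. lam + c_im A h) = 1"
    by (metis assms(1) bhat_def matrix_inv_cancel(2) matrix_vector_mul_assoc matrix_vector_mul_lid)
  then have "(\<Sum>h\<le>i. bhat lam A $ i $ h * (lam + c_im A h)) = 1"
    using bhat_mult_vec[OF assms, of "\<chi> h. lam + c_im A h" i] by simp
  then show ?thesis
    by (simp add: distrib_left sum.distrib sum_distrib_left mult.commute[of lam])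
qed

lemma sum_triangle_swap:
  fixes i :: "'s::{finite,linorder}" and a :: "'s \<Rightarrow> 's \<Rightarrow> real"
  shows "(\<Sum>h\<le>i. b h * (\<Sum>j<h. a h j * p j)) = (\<Sum>j<i. (\<Sum>h\<in>{j<..i}. b h * a h j) * p j)"
proof -
  have "(\<Sum>h\<le>i. b h * (\<Sum>j<h. a h j * p j))
      = (\<Sum>h\<le>i. \<Sum>j\<in>{j \<in> {..<i}. j < h}. b h * a h j * p j)"
    by (intro sum.cong) (auto simp: sum_distrib_left mult.assoc intro!: sum.cong)
  also have "\<dots> = (\<Sum>j<i. \<Sum>h\<in>{h \<in> {..i}. j < h}. b h * a h j * p j)"
    by (intro sum.swap_restrict) auto
  also have "\<dots> = (\<Sum>j<i. (\<Sum>h\<in>{j<..i}. b h * a h j) * p j)"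
    by (intro sum.cong) (auto simp: sum_distrib_right intro!: sum.cong)
  finally show ?thesis .
qed

text \<open>
  Exchanging the order of summation isolates, for each earlier stage, the coefficient of its
  collision term; these coefficients are the quantities that the sign conditions of the scheme control.
\<close>

lemma stage_expansion:
  assumes "imex_stages B \<mu> lam At A f F"
  shows "F i v = lam * (\<Sum>h\<le>i. bhat lam A $ i $ h) * f v
      + (\<Sum>j<i. (\<Sum>h\<in>{j<..i}. bhat lam A $ i $ h * At $ h $ j) * (P_op B \<mu> (F j) v / \<mu>))
      + (\<Sum>h\<le>i. bhat lam A $ i $ h * (c_im A h - c_ex At h)) * maxwellian f v"
proof -
  let ?b = "\<lambda>h. bhat lam A $ i $ h" and ?p = "\<lambda>j. P_op B \<mu> (F j) v / \<mu>"
  have "F i v = (\<Sum>h\<le>i. ?b h * (lam * f v + (\<Sum>j<h. At $ h $ j * ?p j)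
             + maxwellian f v * (c_im A h - c_ex At h)))"
    using assms unfolding imex_stages_def by blast
  also have "\<dots> = lam * (\<Sum>h\<le>i. ?b h) * f v + (\<Sum>h\<le>i. ?b h * (\<Sum>j<h. At $ h $ j * ?p j))
      + (\<Sum>h\<le>i. ?b h * (c_im A h - c_ex At h)) * maxwellian f v"
    unfolding sum_distrib_left[of lam] sum_distrib_right sum.distrib[symmetric]
    by (intro sum.cong) (simp_all add: algebra_simps)
  finally show ?thesis
    unfolding sum_triangle_swap .
qed

text \<open>
  The total weight of the collision terms is \<open>\<Sum>\<^sub>h bhat\<^sub>i\<^sub>h c\<^sub>h\<close> formed with the explicit abscissae, which
  cancels against the explicit part of the weight of the Maxwellian; the remainder is the row
  identity for \<open>bhat\<close>.
\<close>

lemma stage_weights_sum: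
  assumes "invertible (mat lam + A)" "diag_implicit_tableau A"
  shows "lam * (\<Sum>h\<le>i. bhat lam A $ i $ h)
      + (\<Sum>j<i. \<Sum>h\<in>{j<..i}. bhat lam A $ i $ h * At $ h $ j)
      + (\<Sum>h\<le>i. bhat lam A $ i $ h * (c_im A h - c_ex At h)) = 1"
proof -
  have "(\<Sum>j<i. \<Sum>h\<in>{j<..i}. bhat lam A $ i $ h * At $ h $ j)
      = (\<Sum>h\<le>i. bhat lam A $ i $ h * c_ex At h)"
    using sum_triangle_swap[of "\<lambda>h. bhat lam A $ i $ h" "\<lambda>h j. At $ h $ j" "\<lambda>_. 1" i]
    by (simp add: c_ex_def)
  then show ?thesis
    by (simp add: bhat_row_sum[OF assms] right_diff_distrib sum_subtractf)
qed

lemma same_moment_densities_convex_combination: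
  fixes \<beta> :: "'j \<Rightarrow> real"
  assumes "mass r > 0"
    and f: "f \<in> same_moment_densities r" and M: "M \<in> same_moment_densities r"
    and g: "finite J" "\<And>j. j \<in> J \<Longrightarrow> g j \<in> same_moment_densities r"
    and weights: "0 \<le> \<alpha>" "0 \<le> \<gamma>" "\<And>j. j \<in> J \<Longrightarrow> 0 \<le> \<beta> j" "\<alpha> + sum \<beta> J + \<gamma> = 1"
  shows "(\<lambda>v. \<alpha> * f v + (\<Sum>j\<in>J. \<beta> j * g j v) + \<gamma> * M v) \<in> same_moment_densities r"
proof -
  let ?m = "mass r" and ?p = "momentum r" and ?e = "energy r"
  note iff = same_moment_densities_iff[OF \<open>mass r > 0\<close>]
  have "moments_are f ?m ?p ?e" "moments_are M ?m ?p ?e"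
    "\<And>j. j \<in> J \<Longrightarrow> moments_are (g j) ?m ?p ?e"
    using f M g(2) by (auto simp: iff)
  then have "moments_are (\<lambda>v. \<alpha> * f v + (\<Sum>j\<in>J. \<beta> j * g j v) + \<gamma> * M v)
      (\<alpha> * ?m + sum \<beta> J * ?m + \<gamma> * ?m)
      (\<alpha> *\<^sub>R ?p + sum \<beta> J *\<^sub>R ?p + \<gamma> *\<^sub>R ?p)
      (\<alpha> * ?e + sum \<beta> J * ?e + \<gamma> * ?e)"
    by (intro moments_are_add moments_are_weighted_sum moments_are_scale g(1))
  then have "moments_are (\<lambda>v. \<alpha> * f v + (\<Sum>j\<in>J. \<beta> j * g j v) + \<gamma> * M v) ?m ?p ?e"
    by (simp only: distrib_right[symmetric] scaleR_add_left[symmetric] weights(4) mult_1 scaleR_one)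
  moreover have "0 \<le> \<alpha> * f v + (\<Sum>j\<in>J. \<beta> j * g j v) + \<gamma> * M v" for v
    using f M g weights by (auto simp: iff intro!: add_nonneg_nonneg sum_nonneg)
  ultimately show ?thesis
    by (simp add: iff)
qed

lemma finite_linorder_induct:
  fixes i :: "'s::{finite,linorder}"
  assumes "\<And>i. (\<And>j. j < i \<Longrightarrow> Q j) \<Longrightarrow> Q i"
  shows "Q i"
proof (induction i rule: measure_induct_rule[where f = "\<lambda>i. card {..<i}"])
  case (less i)
  have "card {..<j} < card {..<i}" if "j < i" for j
    using that by (intro psubset_card_mono) auto
  with less show ?case
    by (auto intro: assms)
qed

section \<open>Stiff accuracy\<close>

text \<open>
  Multiplying the stages by \<open>\<lambda> I + A\<close> undoes the inverse and returns the equations that the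
  explicit formula solves.
\<close>

lemma stage_implicit_form:
  assumes inv: "invertible (mat lam + A)" and diag: "diag_implicit_tableau A"
    and stages: "imex_stages B \<mu> lam At A f F"
  shows "lam * F i v + (\<Sum>j\<in>UNIV. A $ i $ j * F j v) =
      lam * f v + (\<Sum>j<i. At $ i $ j * (P_op B \<mu> (F j) v / \<mu>))
        + maxwellian f v * (c_im A i - c_ex At i)"
proof -
  define R where "R = (\<chi> h. lam * f v + (\<Sum>j<h. At $ h $ j * (P_op B \<mu> (F j) v / \<mu>))
        + maxwellian f v * (c_im A h - c_ex At h))"
  have "(\<chi> i. F i v) = bhat lam A *v R"
    using stages by (simp add: vec_eq_iff bhat_mult_vec[OF inv diag] R_def imex_stages_def)
  then have "(mat lam + A) *v (\<chi> i. F i v) = R"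
    by (simp add: bhat_def matrix_vector_mul_assoc matrix_inv_cancel[OF inv])
  then have "((mat lam + A) *v (\<chi> i. F i v)) $ i = R $ i"
    by simp
  then show ?thesis
    by (simp add: mat_plus_mult_vec R_def)
qed

text \<open>
  With weights equal to the last rows of the tableaux, the increment of the update is
  \<open>1 / \<lambda>\<close> times the difference between the right-hand side without \<open>\<lambda> f\<close> and the implicit sum in
  the last stage equation, which is \<open>\<lambda> (F\<^sub>\<nu> - f)\<close>.
\<close>

lemma imex_update_eq_last_stage:
  fixes At A :: "('s::{finite,linorder}) tableau"
  assumes "\<mu> > 0" "\<epsilon> > 0" "\<Delta>t > 0" and lam: "lam = \<epsilon> / (\<mu> * \<Delta>t)"
    and expl: "explicit_tableau At" and diag: "diag_implicit_tableau A"
    and inv: "invertible (mat lam + A)"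
    and stages: "imex_stages B \<mu> lam At A f F"
    and gsa: "globally_stiffly_accurate At A wt w"
  shows "imex_update B \<mu> \<epsilon> \<Delta>t wt w f F v = F (Max UNIV) v"
proof -
  let ?n = "Max UNIV :: 's" and ?p = "\<lambda>j. P_op B \<mu> (F j) v / \<mu>" and ?M = "maxwellian f v"
  have "lam > 0" and inv_lam: "\<mu> * \<Delta>t / \<epsilon> = 1 / lam"
    using assms(1-3) by (auto simp: lam)
  have explicit_sum: "(\<Sum>j\<in>UNIV. wt $ j * q j) = (\<Sum>j<?n. At $ ?n $ j * q j)" for q
    using gsa expl unfolding globally_stiffly_accurate_def explicit_tableau_def
    by (intro sum.mono_neutral_cong_right) (auto simp: not_less)
  have ex: "(\<Sum>j\<in>UNIV. wt $ j * (?p j - ?M)) = (\<Sum>j<?n. At $ ?n $ j * ?p j) - c_ex At ?n * ?M"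
    unfolding explicit_sum by (simp add: right_diff_distrib sum_subtractf sum_distrib_right c_ex_def)
  have im: "(\<Sum>j\<in>UNIV. w $ j * (?M - F j v)) = c_im A ?n * ?M - (\<Sum>j\<in>UNIV. A $ ?n $ j * F j v)"
    using gsa by (simp add: globally_stiffly_accurate_def right_diff_distrib sum_subtractf
        sum_distrib_right c_im_def)
  have "imex_update B \<mu> \<epsilon> \<Delta>t wt w f F v
      = f v + 1 / lam * ((\<Sum>j<?n. At $ ?n $ j * ?p j) + ?M * (c_im A ?n - c_ex At ?n)
                          - (\<Sum>j\<in>UNIV. A $ ?n $ j * F j v))"
    unfolding imex_update_def inv_lam ex im by (simp add: algebra_simps)
  also have "(\<Sum>j<?n. At $ ?n $ j * ?p j) + ?M * (c_im A ?n - c_ex At ?n)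
                          - (\<Sum>j\<in>UNIV. A $ ?n $ j * F j v) = lam * F ?n v - lam * f v"
    using stage_implicit_form[OF inv diag stages, of ?n v] by linarith
  also have "f v + 1 / lam * (lam * F ?n v - lam * f v) = F ?n v"
    using \<open>lam > 0\<close> by (simp add: field_simps)
  finally show ?thesis .
qed

theorem theorem2:
  fixes B :: "real \<Rightarrow> real^3 \<Rightarrow> real"
    and \<mu> \<epsilon> \<Delta>t lam :: real
    and At A :: "('s::{finite,linorder}) tableau"
    and wt w :: "'s weights"
    and f f_new :: "real^3 \<Rightarrow> real"
    and F :: "'s \<Rightarrow> real^3 \<Rightarrow> real"
  assumes "\<mu> > 0" and "\<epsilon> > 0" and "\<Delta>t > 0"
    and "lam = \<epsilon> / (\<mu> * \<Delta>t)"
    and kernel_nonneg: "\<And>r n. r \<ge> 0 \<Longrightarrow> n \<in> sphere 0 1 \<Longrightarrow> B r n \<ge> 0"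
    and moments: "has_moments f" "mass f > 0" "temperature f > 0"
    and P_nonneg: "\<And>g v. g \<in> same_moment_densities f \<Longrightarrow> P_op B \<mu> g v \<ge> 0"
    and P_moments: "\<And>g. g \<in> same_moment_densities f \<Longrightarrow>
          has_moments (P_op B \<mu> g) \<and>
          (1 / \<mu>) * mass (P_op B \<mu> g) = mass g \<and>
          (1 / \<mu>) *\<^sub>R momentum (P_op B \<mu> g) = momentum g \<and>
          (1 / \<mu>) * energy (P_op B \<mu> g) = energy g"
    and tableaux: "explicit_tableau At" "diag_implicit_tableau A"
    and "invertible (mat lam + A)"
    and stages: "imex_stages B \<mu> lam At A f F"
    and update: "\<And>v. f_new v = imex_update B \<mu> \<epsilon> \<Delta>t wt w f F v"
    and gsa: "globally_stiffly_accurate At A wt w"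
    and cond1: "\<And>i. 0 \<le> (\<Sum>h\<le>i. bhat lam A $ i $ h * c_im A h)"
               "\<And>i. (\<Sum>h\<le>i. bhat lam A $ i $ h * c_im A h) \<le> 1"
    and cond2: "\<And>i. 0 \<le> (\<Sum>h\<le>i. bhat lam A $ i $ h * (c_im A h - c_ex At h))"
               "\<And>i. (\<Sum>h\<le>i. bhat lam A $ i $ h * (c_im A h - c_ex At h)) \<le> 1"
    and cond3: "\<And>i j. j < i \<Longrightarrow> 0 \<le> (\<Sum>h\<in>{j<..i}. bhat lam A $ i $ h * At $ h $ j)"
               "\<And>i j. j < i \<Longrightarrow> (\<Sum>h\<in>{j<..i}. bhat lam A $ i $ h * At $ h $ j) \<le> 1"
    and f_nonneg: "\<And>v. f v \<ge> 0"
  shows "\<forall>v. f_new v \<ge> 0"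
proof -
  have f_mem: "f \<in> same_moment_densities f"
    using f_nonneg moments by (simp add: same_moment_densities_def)
  have M_mem: "maxwellian f \<in> same_moment_densities f"
    using moments by (simp add: same_moment_densities_iff maxwellian_nonneg maxwellian_moments)
  have P_mem: "(\<lambda>v. P_op B \<mu> g v / \<mu>) \<in> same_moment_densities f"
    if g: "g \<in> same_moment_densities f" for g
  proof -
    have "moments_are g (mass f) (momentum f) (energy f)"
      using g moments by (simp add: same_moment_densities_iff)
    then have "moments_are (\<lambda>v. 1 / \<mu> * P_op B \<mu> g v) (mass f) (momentum f) (energy f)"
      using moments_are_scale[of "P_op B \<mu> g" "mass (P_op B \<mu> g)" "momentum (P_op B \<mu> g)"
          "energy (P_op B \<mu> g)" "1 / \<mu>"] P_moments[OF g]
      by (simp add: moments_are_iff)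
    then show ?thesis
      using P_nonneg[OF g] \<open>\<mu> > 0\<close> moments by (simp add: same_moment_densities_iff)
  qed
  have F_mem: "F i \<in> same_moment_densities f" for i
  proof (induction i rule: finite_linorder_induct)
    case (1 i)
    have "0 \<le> lam * (\<Sum>h\<le>i. bhat lam A $ i $ h)"
      using cond1(2)[of i] bhat_row_sum[OF \<open>invertible (mat lam + A)\<close> tableaux(2), of i] by simp
    then show ?case
      unfolding stage_expansion[OF stages, of i, abs_def]
      using 1 stage_weights_sum[OF \<open>invertible (mat lam + A)\<close> tableaux(2), of i At] cond2(1) cond3(1)
      by (intro same_moment_densities_convex_combination f_mem M_mem P_mem moments) auto
  qed
  have "f_new v = F (Max UNIV) v" for v
    unfolding update
    by (rule imex_update_eq_last_stage[OF assms(1-4) tableaux \<open>invertible (mat lam + A)\<close> stages gsa])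
  then show ?thesis
    using F_mem by (simp add: same_moment_densities_def)
qed

end
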